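(* Let $p$ be a prime and $n\ge 1$. If $h$ is a non-central element of $\mathcal{H}(p^n)$, then $|P(h)| = p\,|C(h)|$. Hence $P(h)/C(h)\cong \mathbb{Z}_p$.
   Context: For an integer $r\ge 1$, $\mathcal{H}(r)$ denotes the Heisenberg group of $3\times3$ upper unitriangular matrices over $\mathbb{Z}_r=\mathbb{Z}/r\mathbb{Z}$ (trivial if $r=1$). The matrix with $(1,2)$-entry $a_1$, $(1,3)$-entry $a_2$, $(2,3)$-entry $a_3$ is written $(a_1,a_2,a_3)$, so $(a_1,a_2,a_3)(b_1,b_2,b_3)=(a_1+b_1,\,a_2+b_2+a_1b_3,\,a_3+b_3)$. Let $q:\mathcal{H}(p^n)\to\mathcal{H}(p^{n-1})$ be the surjective homomorphism reducing each component mod $p^{n-1}$. With $[x,y]=x^{-1}y^{-1}xy$, the pseudocentralizer of $h\in\mathcal{H}(p^n)$ is $P(h)=\{g\in\mathcal{H}(p^n) : [h,g]\in\ker q\}$, a subgroup of $\mathcal{H}(p^n)$. $C(h)$ is the centralizer of $h$ in $\mathcal{H}(p^n)$; it is a normal subgroup of $P(h)$. *)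

theory Defs
  imports "HOL-Algebra.Elementary_Groups" "HOL-Number_Theory.Cong"
begin

definition commutator :: "('a, 'b) monoid_scheme \<Rightarrow> 'a \<Rightarrow> 'a \<Rightarrow> 'a" where
  "commutator G x y = inv\<^bsub>G\<^esub> x \<otimes>\<^bsub>G\<^esub> inv\<^bsub>G\<^esub> y \<otimes>\<^bsub>G\<^esub> x \<otimes>\<^bsub>G\<^esub> y"

definition group_center :: "('a, 'b) monoid_scheme \<Rightarrow> 'a set" where
  "group_center G = {z \<in> carrier G. \<forall>g \<in> carrier G. z \<otimes>\<^bsub>G\<^esub> g = g \<otimes>\<^bsub>G\<^esub> z}"

definition centralizer :: "('a, 'b) monoid_scheme \<Rightarrow> 'a \<Rightarrow> 'a set" where
  "centralizer G h = {g \<in> carrier G. g \<otimes>\<^bsub>G\<^esub> h = h \<otimes>\<^bsub>G\<^esub> g}"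

text \<open>The triple \<open>(a1, a2, a3)\<close>, with entries reduced to \<open>{0..<r}\<close>, stands for the upper
  unitriangular matrix with (1,2)-entry \<open>a1\<close>, (1,3)-entry \<open>a2\<close> and (2,3)-entry \<open>a3\<close>.\<close>

definition heisenberg :: "nat \<Rightarrow> (int \<times> int \<times> int) monoid" where
  "heisenberg r =
    \<lparr>carrier = {0..<int r} \<times> {0..<int r} \<times> {0..<int r},
     monoid.mult = (\<lambda>(a1, a2, a3) (b1, b2, b3).
       ((a1 + b1) mod int r, (a2 + b2 + a1 * b3) mod int r, (a3 + b3) mod int r)),
     one = (0, 0, 0)\<rparr>"

definition heisenberg_reduce :: "nat \<Rightarrow> int \<times> int \<times> int \<Rightarrow> int \<times> int \<times> int" where
  "heisenberg_reduce r = (\<lambda>(a1, a2, a3). (a1 mod int r, a2 mod int r, a3 mod int r))"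

definition pseudocentralizer :: "nat \<Rightarrow> nat \<Rightarrow> int \<times> int \<times> int \<Rightarrow> (int \<times> int \<times> int) set" where
  "pseudocentralizer p n h =
    {g \<in> carrier (heisenberg (p ^ n)).
      commutator (heisenberg (p ^ n)) h g
        \<in> kernel (heisenberg (p ^ n)) (heisenberg (p ^ (n - 1))) (heisenberg_reduce (p ^ (n - 1)))}"

text \<open>Agreement with the matrix description (rows and columns numbered from 0).\<close>

definition heisenberg_matrix :: "int \<times> int \<times> int \<Rightarrow> nat \<Rightarrow> nat \<Rightarrow> int" where
  "heisenberg_matrix = (\<lambda>(a1, a2, a3) i j.
     if i = j then 1
     else if i = 0 \<and> j = 1 then a1
     else if i = 0 \<and> j = 2 then a2
     else if i = 1 \<and> j = 2 then a3
     else 0)"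

lemma heisenberg_mult_matrix:
  assumes "i < 3" "j < 3"
  shows "[heisenberg_matrix (a \<otimes>\<^bsub>heisenberg r\<^esub> b) i j =
    (\<Sum>k<3. heisenberg_matrix a i k * heisenberg_matrix b k j)] (mod int r)"
proof -
  obtain a1 a2 a3 b1 b2 b3 where [simp]: "a = (a1, a2, a3)" "b = (b1, b2, b3)"
    by (metis prod_cases3)
  have "i = 0 \<or> i = 1 \<or> i = 2" "j = 0 \<or> j = 1 \<or> j = 2"
    using assms by auto
  then show ?thesis
    by (elim disjE) (simp_all add: heisenberg_def heisenberg_matrix_def
        eval_nat_numeral cong_def algebra_simps)
qed

lemma mod_inner_simps:
  fixes x y z r :: int
  shows "(x + (y mod r) * z) mod r = (x + y * z) mod r"
    and "(x + y * (z mod r)) mod r = (x + y * z) mod r"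
    and "(x + y mod r + z) mod r = (x + y + z) mod r"
    and "(x mod r + y + z) mod r = (x + y + z) mod r"
    and "(x - (y mod r) * z) mod r = (x - y * z) mod r"
    and "(x - y * (z mod r)) mod r = (x - y * z) mod r"
    and "(x + y mod r - z) mod r = (x + y - z) mod r"
    and "(x mod r + y - z) mod r = (x + y - z) mod r"
    and "(y * (z mod r) - x) mod r = (y * z - x) mod r"
  by (metis mod_add_right_eq mod_mult_left_eq, metis mod_add_right_eq mod_mult_right_eq,
      metis mod_add_left_eq mod_add_right_eq, metis mod_add_left_eq,
      metis mod_diff_right_eq mod_mult_left_eq, metis mod_diff_right_eq mod_mult_right_eq,
      metis mod_diff_left_eq mod_add_right_eq, metis mod_diff_left_eq mod_add_left_eq,
      metis mod_diff_left_eq mod_mult_right_eq)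

lemma heisenberg_group:
  assumes "r \<ge> 1"
  shows "group (heisenberg r)"
proof (rule groupI)
  fix x y assume "x \<in> carrier (heisenberg r)" "y \<in> carrier (heisenberg r)"
  then show "x \<otimes>\<^bsub>heisenberg r\<^esub> y \<in> carrier (heisenberg r)"
    using assms by (auto simp: heisenberg_def)
next
  show "\<one>\<^bsub>heisenberg r\<^esub> \<in> carrier (heisenberg r)"
    using assms by (simp add: heisenberg_def)
next
  fix x y z assume "x \<in> carrier (heisenberg r)" "y \<in> carrier (heisenberg r)" "z \<in> carrier (heisenberg r)"
  then show "x \<otimes>\<^bsub>heisenberg r\<^esub> y \<otimes>\<^bsub>heisenberg r\<^esub> z
      = x \<otimes>\<^bsub>heisenberg r\<^esub> (y \<otimes>\<^bsub>heisenberg r\<^esub> z)"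
    by (auto simp: heisenberg_def mod_simps mod_inner_simps) (simp_all add: algebra_simps)
next
  fix x assume "x \<in> carrier (heisenberg r)"
  then show "\<one>\<^bsub>heisenberg r\<^esub> \<otimes>\<^bsub>heisenberg r\<^esub> x = x"
    by (auto simp: heisenberg_def)
next
  fix x assume x: "x \<in> carrier (heisenberg r)"
  obtain a b c where [simp]: "x = (a, b, c)" by (metis prod_cases3)
  have "((- a) mod int r, (a * c - b) mod int r, (- c) mod int r) \<in> carrier (heisenberg r)"
    using assms by (simp add: heisenberg_def)
  moreover have "((- a) mod int r, (a * c - b) mod int r, (- c) mod int r) \<otimes>\<^bsub>heisenberg r\<^esub> x
      = \<one>\<^bsub>heisenberg r\<^esub>"
    by (simp add: heisenberg_def mod_simps mod_inner_simps)
  ultimately show "\<exists>y\<in>carrier (heisenberg r). y \<otimes>\<^bsub>heisenberg r\<^esub> x = \<one>\<^bsub>heisenberg r\<^esub>"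
    by blast
qed

lemma heisenberg_inv:
  assumes "r \<ge> 1" "(a, b, c) \<in> carrier (heisenberg r)"
  shows "inv\<^bsub>heisenberg r\<^esub> (a, b, c) = ((- a) mod int r, (a * c - b) mod int r, (- c) mod int r)"
proof -
  interpret group "heisenberg r" using assms(1) by (rule heisenberg_group)
  have "((- a) mod int r, (a * c - b) mod int r, (- c) mod int r) \<in> carrier (heisenberg r)"
    using assms by (simp add: heisenberg_def)
  moreover have "((- a) mod int r, (a * c - b) mod int r, (- c) mod int r) \<otimes>\<^bsub>heisenberg r\<^esub> (a, b, c)
      = \<one>\<^bsub>heisenberg r\<^esub>"
    by (simp add: heisenberg_def mod_simps mod_inner_simps)
  ultimately show ?thesis
    using assms(2) inv_equality by blast
qed

lemma heisenberg_commutator: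
  assumes "r \<ge> 1" "(a, b, c) \<in> carrier (heisenberg r)" "(a', b', c') \<in> carrier (heisenberg r)"
  shows "commutator (heisenberg r) (a, b, c) (a', b', c') = (0, (a * c' - a' * c) mod int r, 0)"
proof -
  interpret group "heisenberg r" using assms(1) by (rule heisenberg_group)
  let ?x = "(a, b, c)" and ?y = "(a', b', c')" and ?z = "(0, (a * c' - a' * c) mod int r, 0)"
  have z: "?z \<in> carrier (heisenberg r)"
    using assms(1) by (simp add: heisenberg_def)
  have "?x \<otimes>\<^bsub>heisenberg r\<^esub> ?y = (?y \<otimes>\<^bsub>heisenberg r\<^esub> ?x) \<otimes>\<^bsub>heisenberg r\<^esub> ?z"
    by (simp add: heisenberg_def mod_simps mod_inner_simps) (simp add: algebra_simps)
  then have "inv\<^bsub>heisenberg r\<^esub> (?y \<otimes>\<^bsub>heisenberg r\<^esub> ?x) \<otimes>\<^bsub>heisenberg r\<^esub>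
      (?x \<otimes>\<^bsub>heisenberg r\<^esub> ?y) = ?z"
    using inv_solve_left'[OF z m_closed[OF assms(3,2)] m_closed[OF assms(2,3)]] by simp
  then show ?thesis
    unfolding commutator_def inv_mult_group[OF assms(3,2)]
    using m_assoc[OF m_closed[OF inv_closed[OF assms(2)] inv_closed[OF assms(3)]] assms(2,3)] by (simp only:)
qed

lemma heisenberg_reduce_hom:
  assumes "s dvd r" "s \<ge> 1"
  shows "heisenberg_reduce s \<in> hom (heisenberg r) (heisenberg s)"
  using assms
  by (auto simp: hom_def heisenberg_def heisenberg_reduce_def mod_mod_cancel mod_simps mod_inner_simps)

lemma heisenberg_reduce_surj:
  assumes "s dvd r" "s \<ge> 1" "r \<ge> 1"
  shows "heisenberg_reduce s ` carrier (heisenberg r) = carrier (heisenberg s)"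
proof
  show "heisenberg_reduce s ` carrier (heisenberg r) \<subseteq> carrier (heisenberg s)"
    using assms by (auto simp: heisenberg_def heisenberg_reduce_def)
  show "carrier (heisenberg s) \<subseteq> heisenberg_reduce s ` carrier (heisenberg r)"
  proof
    fix x assume x: "x \<in> carrier (heisenberg s)"
    have "s \<le> r" using assms by (simp add: dvd_imp_le)
    then have "x \<in> carrier (heisenberg r)" "heisenberg_reduce s x = x"
      using x by (auto simp: heisenberg_def heisenberg_reduce_def)
    then show "x \<in> heisenberg_reduce s ` carrier (heisenberg r)"
      by (metis image_eqI)
  qed
qed

lemma pseudocentralizer_iff:
  assumes "p \<ge> 1" "(a, b, c) \<in> carrier (heisenberg (p ^ n))"
  shows "(a', b', c') \<in> pseudocentralizer p n (a, b, c) \<longleftrightarrow>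
    (a', b', c') \<in> carrier (heisenberg (p ^ n)) \<and> int (p ^ (n - 1)) dvd a * c' - a' * c"
proof -
  have r: "p ^ n \<ge> 1" using assms(1) by simp
  have dvd: "int (p ^ (n - 1)) dvd int (p ^ n)"
    by (simp add: le_imp_power_dvd)
  have "commutator (heisenberg (p ^ n)) (a, b, c) (a', b', c')
      \<in> kernel (heisenberg (p ^ n)) (heisenberg (p ^ (n - 1))) (heisenberg_reduce (p ^ (n - 1)))
    \<longleftrightarrow> int (p ^ (n - 1)) dvd a * c' - a' * c"
    if "(a', b', c') \<in> carrier (heisenberg (p ^ n))"
    unfolding heisenberg_commutator[OF r assms(2) that] kernel_def
    using r assms(1) mod_mod_cancel[OF dvd, of "a * c' - a' * c"]
    by (auto simp: heisenberg_def heisenberg_reduce_def dvd_eq_mod_eq_0)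
  then show ?thesis
    unfolding pseudocentralizer_def by blast
qed

lemma pseudocentralizer_subgroup:
  assumes "p \<ge> 1" "h \<in> carrier (heisenberg (p ^ n))"
  shows "subgroup (pseudocentralizer p n h) (heisenberg (p ^ n))"
proof -
  obtain a b c where h: "h = (a, b, c)" by (metis prod_cases3)
  have r: "p ^ n \<ge> 1" using assms(1) by simp
  interpret group "heisenberg (p ^ n)" using r by (rule heisenberg_group)
  have dvd: "int (p ^ (n - 1)) dvd int (p ^ n)"
    by (simp add: le_imp_power_dvd)
  note iff = pseudocentralizer_iff[OF assms(1) assms(2)[unfolded h], folded h]
  have cong: "int (p ^ (n - 1)) dvd a * (x mod int (p ^ n)) - (y mod int (p ^ n)) * c
      \<longleftrightarrow> int (p ^ (n - 1)) dvd a * x - y * c" for x y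
  proof -
    have "int (p ^ n) dvd (a * x - y * c) - (a * (x mod int (p ^ n)) - (y mod int (p ^ n)) * c)"
      by (simp add: mod_eq_dvd_iff [symmetric] mod_inner_simps)
    then have "int (p ^ (n - 1)) dvd (a * x - y * c) - (a * (x mod int (p ^ n)) - (y mod int (p ^ n)) * c)"
      using dvd dvd_trans by blast
    then show ?thesis
      by (metis diff_add_cancel dvd_add_right_iff)
  qed
  show ?thesis
  proof (rule subgroupI)
    show "pseudocentralizer p n h \<subseteq> carrier (heisenberg (p ^ n))"
      by (auto simp: pseudocentralizer_def)
    have "\<one>\<^bsub>heisenberg (p ^ n)\<^esub> \<in> pseudocentralizer p n h"
      using iff[of 0 0 0] one_closed by (simp add: heisenberg_def)
    then show "pseudocentralizer p n h \<noteq> {}" by blast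
  next
    fix x assume x: "x \<in> pseudocentralizer p n h"
    obtain u v w where xe: "x = (u, v, w)" by (metis prod_cases3)
    have xc: "(u, v, w) \<in> carrier (heisenberg (p ^ n))" and d: "int (p ^ (n - 1)) dvd a * w - u * c"
      using x xe iff by auto
    have "int (p ^ (n - 1)) dvd a * (- w) - (- u) * c"
      using d by (metis dvd_minus_iff minus_diff_eq mult_minus_left mult_minus_right diff_minus_eq_add uminus_add_conv_diff)
    then show "inv\<^bsub>heisenberg (p ^ n)\<^esub> x \<in> pseudocentralizer p n h"
      using iff cong inv_closed[OF xc] heisenberg_inv[OF r xc] xe by simp
  next
    fix x y assume x: "x \<in> pseudocentralizer p n h" and y: "y \<in> pseudocentralizer p n h"
    obtain u v w where xe: "x = (u, v, w)" by (metis prod_cases3)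
    obtain u' v' w' where ye: "y = (u', v', w')" by (metis prod_cases3)
    have xc: "x \<in> carrier (heisenberg (p ^ n))" and d: "int (p ^ (n - 1)) dvd a * w - u * c"
      using x xe iff by auto
    have yc: "y \<in> carrier (heisenberg (p ^ n))" and d': "int (p ^ (n - 1)) dvd a * w' - u' * c"
      using y ye iff by auto
    have "int (p ^ (n - 1)) dvd a * (w + w') - (u + u') * c"
      using dvd_add[OF d d'] by (simp add: algebra_simps)
    moreover have "x \<otimes>\<^bsub>heisenberg (p ^ n)\<^esub> y =
        ((u + u') mod int (p ^ n), (v + v' + u * w') mod int (p ^ n), (w + w') mod int (p ^ n))"
      by (simp add: xe ye heisenberg_def)
    ultimately show "x \<otimes>\<^bsub>heisenberg (p ^ n)\<^esub> y \<in> pseudocentralizer p n h"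
      using iff cong m_closed[OF xc yc] by simp
  qed
qed

lemma centralizer_heisenberg_iff:
  assumes "(a, b, c) \<in> carrier (heisenberg r)"
  shows "(a', b', c') \<in> centralizer (heisenberg r) (a, b, c) \<longleftrightarrow>
    (a', b', c') \<in> carrier (heisenberg r) \<and> int r dvd a * c' - a' * c"
proof -
  have "(a' * c + (b' + b)) mod int r = (a * c' + (b + b')) mod int r
      \<longleftrightarrow> int r dvd a * c' - a' * c"
    by (subst eq_commute) (simp add: mod_eq_dvd_iff)
  then show ?thesis
    by (auto simp: centralizer_def heisenberg_def algebra_simps)
qed

lemma centralizer_normal:
  assumes "p \<ge> 1" "h \<in> carrier (heisenberg (p ^ n))"
  shows "centralizer (heisenberg (p ^ n)) h \<lhd>
    heisenberg (p ^ n)\<lparr>carrier := pseudocentralizer p n h\<rparr>"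
proof -
  let ?G = "heisenberg (p ^ n)"
  let ?P = "pseudocentralizer p n h"
  let ?C = "centralizer ?G h"
  obtain a b c where h: "h = (a, b, c)" by (metis prod_cases3)
  have r: "p ^ n \<ge> 1" using assms(1) by simp
  interpret G: group ?G using r by (rule heisenberg_group)
  have dvd: "int (p ^ (n - 1)) dvd int (p ^ n)"
    by (simp add: le_imp_power_dvd)
  note sg = pseudocentralizer_subgroup[OF assms]
  note Ciff = centralizer_heisenberg_iff[OF assms(2)[unfolded h], folded h]
  note Piff = pseudocentralizer_iff[OF assms(1) assms(2)[unfolded h], folded h]
  interpret P: group "?G\<lparr>carrier := ?P\<rparr>"
    using sg G.subgroup_imp_group by blast
  have CP: "?C \<subseteq> ?P"
  proof
    fix x assume x: "x \<in> ?C"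
    obtain u v w where xe: "x = (u, v, w)" by (metis prod_cases3)
    show "x \<in> ?P"
      using x Ciff Piff dvd dvd_trans unfolding xe by blast
  qed
  have Csub: "subgroup ?C ?G"
  proof (rule G.subgroupI)
    show "?C \<subseteq> carrier ?G" by (auto simp: centralizer_def)
    have "h \<in> ?C" using assms(2) by (simp add: centralizer_def)
    then show "?C \<noteq> {}" by blast
    show "inv\<^bsub>?G\<^esub> x \<in> ?C" if "x \<in> ?C" for x
    proof -
      have x: "x \<in> carrier ?G" "x \<otimes>\<^bsub>?G\<^esub> h = h \<otimes>\<^bsub>?G\<^esub> x"
        using that by (simp_all add: centralizer_def)
      have "h \<otimes>\<^bsub>?G\<^esub> inv\<^bsub>?G\<^esub> x = inv\<^bsub>?G\<^esub> x \<otimes>\<^bsub>?G\<^esub> (x \<otimes>\<^bsub>?G\<^esub> h) \<otimes>\<^bsub>?G\<^esub> inv\<^bsub>?G\<^esub> x"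
        using x(1) assms(2) by (simp add: G.m_assoc [symmetric])
      also have "\<dots> = inv\<^bsub>?G\<^esub> x \<otimes>\<^bsub>?G\<^esub> h"
        unfolding x(2) using x(1) assms(2) by (simp add: G.m_assoc)
      finally show ?thesis
        using x(1) by (simp add: centralizer_def)
    qed
    show "x \<otimes>\<^bsub>?G\<^esub> y \<in> ?C" if "x \<in> ?C" "y \<in> ?C" for x y
    proof -
      have xy: "x \<in> carrier ?G" "y \<in> carrier ?G"
        "x \<otimes>\<^bsub>?G\<^esub> h = h \<otimes>\<^bsub>?G\<^esub> x" "y \<otimes>\<^bsub>?G\<^esub> h = h \<otimes>\<^bsub>?G\<^esub> y"
        using that by (simp_all add: centralizer_def)
      then have "x \<otimes>\<^bsub>?G\<^esub> y \<otimes>\<^bsub>?G\<^esub> h = h \<otimes>\<^bsub>?G\<^esub> (x \<otimes>\<^bsub>?G\<^esub> y)"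
        using assms(2) by (metis G.m_assoc)
      then show ?thesis
        using xy by (simp add: centralizer_def)
    qed
  qed
  have CsubP: "subgroup ?C (?G\<lparr>carrier := ?P\<rparr>)"
    using G.subgroup_incl[OF Csub sg CP] .
  have conj: "x \<otimes>\<^bsub>?G\<^esub> y \<otimes>\<^bsub>?G\<^esub> inv\<^bsub>?G\<^esub> x \<in> ?C" if x: "x \<in> ?P" and y: "y \<in> ?C" for x y
  proof -
    obtain u v w where xe: "x = (u, v, w)" by (metis prod_cases3)
    obtain u' v' w' where ye: "y = (u', v', w')" by (metis prod_cases3)
    have xc: "x \<in> carrier ?G" and yc: "y \<in> carrier ?G"
      using x y by (auto simp: pseudocentralizer_def centralizer_def)
    have u': "u' mod int (p ^ n) = u'" "w' mod int (p ^ n) = w'"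
      using yc by (auto simp: ye heisenberg_def)
    have "\<exists>z. x \<otimes>\<^bsub>?G\<^esub> y \<otimes>\<^bsub>?G\<^esub> inv\<^bsub>?G\<^esub> x = (u', z, w')"
      unfolding xe ye heisenberg_inv[OF r xc[unfolded xe]]
      using u' by (simp add: heisenberg_def mod_simps mod_inner_simps)
    then obtain z where z: "x \<otimes>\<^bsub>?G\<^esub> y \<otimes>\<^bsub>?G\<^esub> inv\<^bsub>?G\<^esub> x = (u', z, w')" ..
    have "(u', z, w') \<in> carrier ?G"
      using z xc yc G.m_closed G.inv_closed by metis
    then show ?thesis
      using z y Ciff ye by simp
  qed
  show ?thesis
    using P.normal_inv_iff CsubP conj G.m_inv_consistent[OF sg] by simp
qed

end

theory Submission
  imports Defs
begin

text \<open>For \<open>h = (a, b, c)\<close> the commutator \<open>[h, (u, v, w)]\<close> is central with entry \<open>a w - u c\<close>, so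
  \<open>P(h)\<close> and \<open>C(h)\<close> are cut out by \<open>p\<^sup>n\<^sup>-\<^sup>1 dvd a w - u c\<close> and \<open>p\<^sup>n dvd a w - u c\<close>. Hence
  \<open>(u, v, w) \<mapsto> (a w - u c) / p\<^sup>n\<^sup>-\<^sup>1 mod p\<close> is a homomorphism from \<open>P(h)\<close> to the integers modulo \<open>p\<close>
  with kernel \<open>C(h)\<close>. It is onto by Bezout: \<open>h\<close> is non-central, so \<open>gcd(a, c, p\<^sup>n)\<close> divides
  \<open>p\<^sup>n\<^sup>-\<^sup>1\<close>.\<close>

definition commutator_digit :: "nat \<Rightarrow> nat \<Rightarrow> int \<times> int \<times> int \<Rightarrow> int \<times> int \<times> int \<Rightarrow> int" where
  "commutator_digit p n = (\<lambda>(a, b, c) (u, v, w). ((a * w - u * c) div int (p ^ (n - 1))) mod int p)"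

lemma int_power_eq_mult_pred:
  fixes p n :: nat
  assumes "n \<ge> 1"
  shows "int (p ^ n) = int (p ^ (n - 1)) * int p"
  using assms by (metis mult.commute of_nat_mult power_minus_mult less_le_trans zero_less_one)

text \<open>Both sides equal \<open>(z mod (q * p)) div q\<close>, which sees only the residue of
  \<open>z\<close>. With \<open>q\<close> = \<open>p ^ (n - 1)\<close>, it lets the digit of a
  commutator entry ignore the reduction of matrix entries mod \<open>p ^ n\<close>.\<close>

lemma div_mod_cong:
  fixes x y q p :: int
  assumes "q > 0" "p > 0" "x mod (q * p) = y mod (q * p)"
  shows "(x div q) mod p = (y div q) mod p"
proof -
  have "(z div q) mod p = (z mod (q * p)) div q" for z
    using assms(1,2) by (simp add: zmod_zmult2_eq)
  then show ?thesis
    using assms(3) by simp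
qed

text \<open>The commutator entry \<open>a * w - u * c\<close> is additive in \<open>(u, w)\<close>,
  and these two coordinates simply add under the group law. Only the floor division could break
  additivity.\<close>

lemma commutator_digit_hom:
  assumes "p \<ge> 1" "n \<ge> 1" "h \<in> carrier (heisenberg (p ^ n))"
  shows "commutator_digit p n h
    \<in> hom (heisenberg (p ^ n)\<lparr>carrier := pseudocentralizer p n h\<rparr>) (integer_mod_group p)"
proof -
  obtain a b c where h: "h = (a, b, c)" by (metis prod_cases3)
  let ?q = "int (p ^ (n - 1))"
  have q: "?q > 0" "int p > 0" using assms(1) by simp_all
  note N = int_power_eq_mult_pred[OF assms(2), of p]
  note Piff = pseudocentralizer_iff[OF assms(1) assms(3)[unfolded h], folded h]
  show ?thesis
  proof (rule homI)
    fix x assume "x \<in> carrier (heisenberg (p ^ n)\<lparr>carrier := pseudocentralizer p n h\<rparr>)"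
    show "commutator_digit p n h x \<in> carrier (integer_mod_group p)"
      using q(2) by (auto simp: commutator_digit_def h carrier_integer_mod_group split: prod.split)
  next
    fix x y
    assume x: "x \<in> carrier (heisenberg (p ^ n)\<lparr>carrier := pseudocentralizer p n h\<rparr>)"
      and y: "y \<in> carrier (heisenberg (p ^ n)\<lparr>carrier := pseudocentralizer p n h\<rparr>)"
    obtain u v w where xe: "x = (u, v, w)" by (metis prod_cases3)
    obtain u' v' w' where ye: "y = (u', v', w')" by (metis prod_cases3)
    have d: "?q dvd a * w - u * c"
      using x Piff by (simp add: xe)
    have "(a * ((w + w') mod int (p ^ n)) - (u + u') mod int (p ^ n) * c) mod int (p ^ n)
        = (a * (w + w') - (u + u') * c) mod int (p ^ n)"
      by (simp add: mod_inner_simps)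
    then have "((a * ((w + w') mod int (p ^ n)) - (u + u') mod int (p ^ n) * c) div ?q) mod int p
        = ((a * (w + w') - (u + u') * c) div ?q) mod int p"
      using div_mod_cong[OF q] unfolding N by blast
    also have "a * (w + w') - (u + u') * c = (a * w - u * c) + (a * w' - u' * c)"
      by (simp add: algebra_simps)
    \<comment> \<open>No carry arises, because \<open>x\<close> in P(h) makes the first summand an
      exact multiple of \<open>?q\<close>.\<close>
    also have "\<dots> div ?q = (a * w - u * c) div ?q + (a * w' - u' * c) div ?q"
      using d by (rule div_plus_div_distrib_dvd_left)
    finally show "commutator_digit p n h
          (x \<otimes>\<^bsub>heisenberg (p ^ n)\<lparr>carrier := pseudocentralizer p n h\<rparr>\<^esub> y)
        = commutator_digit p n h x \<otimes>\<^bsub>integer_mod_group p\<^esub> commutator_digit p n h y"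
      by (simp add: commutator_digit_def h xe ye heisenberg_def mult_integer_mod_group mod_add_eq)
  qed
qed

lemma commutator_digit_kernel:
  assumes "p \<ge> 1" "n \<ge> 1" "h \<in> carrier (heisenberg (p ^ n))"
  shows "kernel (heisenberg (p ^ n)\<lparr>carrier := pseudocentralizer p n h\<rparr>) (integer_mod_group p)
    (commutator_digit p n h) = centralizer (heisenberg (p ^ n)) h"
proof -
  obtain a b c where h: "h = (a, b, c)" by (metis prod_cases3)
  let ?q = "int (p ^ (n - 1))"
  have q: "?q > 0" using assms(1) by simp
  note N = int_power_eq_mult_pred[OF assms(2), of p]
  note Piff = pseudocentralizer_iff[OF assms(1) assms(3)[unfolded h], folded h]
  note Ciff = centralizer_heisenberg_iff[OF assms(3)[unfolded h], folded h]
  \<comment> \<open>Splits the condition for C(h) into the one for P(h) and the vanishing of the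
    digit.\<close>
  have iff: "int (p ^ n) dvd z \<longleftrightarrow> ?q dvd z \<and> (z div ?q) mod int p = 0" for z
    using q unfolding N by (auto elim!: dvdE simp: mod_eq_0_iff_dvd)
  have "(u, v, w) \<in> kernel (heisenberg (p ^ n)\<lparr>carrier := pseudocentralizer p n h\<rparr>)
      (integer_mod_group p) (commutator_digit p n h)
    \<longleftrightarrow> (u, v, w) \<in> centralizer (heisenberg (p ^ n)) h" for u v w
    unfolding Ciff iff by (auto simp: kernel_def Piff[unfolded h] commutator_digit_def h)
  then show ?thesis
    by auto
qed

text \<open>Entries are reduced, so divisibility by \<open>r\<close> would force
  \<open>a = c = 0\<close>, and every \<open>(0, b, 0)\<close> is central.\<close>

lemma heisenberg_noncentral:
  assumes "(a, b, c) \<in> carrier (heisenberg r)" "(a, b, c) \<notin> group_center (heisenberg r)"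
  shows "\<not> (int r dvd a \<and> int r dvd c)"
proof
  assume "int r dvd a \<and> int r dvd c"
  then have "a = 0" "c = 0"
    using assms(1) by (auto simp: heisenberg_def zdvd_not_zless order.order_iff_strict)
  then show False
    using assms by (auto simp: group_center_def heisenberg_def add.commute)
qed

text \<open>The gcd of \<open>a\<close>, \<open>c\<close> and \<open>p ^ n\<close> is a power
  \<open>p ^ k\<close>. If \<open>k = n\<close>, then \<open>p ^ n\<close> would divide both
  \<open>a\<close> and \<open>c\<close>; so \<open>k \<le> n - 1\<close>, and a multiple of the
  Bezout relation reaches \<open>p ^ (n - 1)\<close>.\<close>

lemma bezout_prime_power:
  fixes a c :: int and p n :: nat
  assumes "prime p" "\<not> (int (p ^ n) dvd a \<and> int (p ^ n) dvd c)"
  obtains x y where "[a * x - y * c = int (p ^ (n - 1))] (mod int (p ^ n))"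
proof -
  define g where "g = gcd (gcd a c) (int (p ^ n))"
  have "nat g dvd p ^ n"
    unfolding g_def by (metis gcd_dvd2 gcd_ge_0_int nat_dvd_iff nat_int_comparison(1) int_dvd_int_iff nat_0_le)
  then obtain k where k: "k \<le> n" "nat g = p ^ k"
    using assms(1) divides_primepow_nat by blast
  have g: "g = int (p ^ k)"
    using k(2) unfolding g_def by (metis gcd_ge_0_int nat_0_le)
  have "k \<noteq> n"
    using assms(2) g unfolding g_def by (metis gcd_dvd1 dvd_trans gcd_dvd2)
  then have "k \<le> n - 1" using k(1) by simp
  then have "g dvd int (p ^ (n - 1))"
    unfolding g by (simp add: le_imp_power_dvd)
  then obtain m where m: "int (p ^ (n - 1)) = g * m" ..
  obtain s t where st: "s * gcd a c + t * int (p ^ n) = g"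
    using bezout_int unfolding g_def by blast
  obtain x y where xy: "x * a + y * c = gcd a c"
    using bezout_int by blast
  \<comment> \<open>The two Bezout relations are composed and scaled by the cofactor
    \<open>m\<close>; the sign of \<open>y\<close> matches the form of the commutator entry.\<close>
  have "a * (x * s * m) - (- y * s * m) * c = int (p ^ (n - 1)) - int (p ^ n) * (t * m)"
    unfolding m st[symmetric] xy[symmetric] by (simp add: algebra_simps)
  then have "[a * (x * s * m) - (- y * s * m) * c = int (p ^ (n - 1))] (mod int (p ^ n))"
    by (simp add: cong_iff_dvd_diff)
  then show thesis by (rule that)
qed

lemma commutator_digit_surj:
  assumes "prime p" "n \<ge> 1" "h \<in> carrier (heisenberg (p ^ n))"
    and "h \<notin> group_center (heisenberg (p ^ n))"
  shows "commutator_digit p n h ` pseudocentralizer p n h = carrier (integer_mod_group p)"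
proof
  have p: "p \<ge> 1" using assms(1) prime_ge_1_nat by blast
  show "commutator_digit p n h ` pseudocentralizer p n h \<subseteq> carrier (integer_mod_group p)"
    using commutator_digit_hom[OF p assms(2,3)] by (auto simp: hom_def)
  obtain a b c where h: "h = (a, b, c)" by (metis prod_cases3)
  let ?q = "int (p ^ (n - 1))" and ?N = "int (p ^ n)"
  have q: "?q > 0" "int p > 0" and N0: "?N > 0" using p by simp_all
  note N = int_power_eq_mult_pred[OF assms(2), of p]
  obtain x y where xy: "[a * x - y * c = ?q] (mod ?N)"
    using bezout_prime_power[OF assms(1) heisenberg_noncentral[OF assms(3,4)[unfolded h]]] .
  show "carrier (integer_mod_group p) \<subseteq> commutator_digit p n h ` pseudocentralizer p n h"
  proof
    fix t assume "t \<in> carrier (integer_mod_group p)"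
    then have t: "0 \<le> t" "t < int p"
      using p by (auto simp: carrier_integer_mod_group)
    \<comment> \<open>Scaling the Bezout solution by \<open>t\<close> turns the commutator entry
      into \<open>t * p ^ (n - 1)\<close>, whose digit is \<open>t\<close>. The middle coordinate
      does not affect the commutator, so 0 will do.\<close>
    let ?g = "((y * t) mod ?N, 0, (x * t) mod ?N)"
    let ?z = "a * ((x * t) mod ?N) - (y * t) mod ?N * c"
    have "?z mod ?N = ((a * x - y * c) * t) mod ?N"
      by (simp add: mod_inner_simps algebra_simps)
    also have "\<dots> = (?q * t) mod ?N"
      using cong_scalar_right[OF xy, of t] by (simp only: cong_def)
    finally have z: "?z mod ?N = (?q * t) mod ?N" .
    have "?q dvd ?z"
      using z unfolding N by (metis dvd_mod_iff dvd_triv_left)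
    moreover have "?g \<in> carrier (heisenberg (p ^ n))"
      using N0 by (simp add: heisenberg_def)
    ultimately have "?g \<in> pseudocentralizer p n h"
      using pseudocentralizer_iff[OF p assms(3)[unfolded h]] by (simp add: h)
    moreover have "(?z div ?q) mod int p = t"
      using div_mod_cong[OF q z[unfolded N], folded N] q(1) t by simp
    then have "commutator_digit p n h ?g = t"
      by (simp add: commutator_digit_def h)
    ultimately show "t \<in> commutator_digit p n h ` pseudocentralizer p n h"
      by (metis image_eqI)
  qed
qed

theorem theorem5p7:
  fixes p n :: nat and h :: "int \<times> int \<times> int"
  assumes "prime p"
    and "n \<ge> 1"
    and "h \<in> carrier (heisenberg (p ^ n))"
    and "h \<notin> group_center (heisenberg (p ^ n))"
  shows "card (pseudocentralizer p n h) = p * card (centralizer (heisenberg (p ^ n)) h)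
    \<and> (heisenberg (p ^ n)\<lparr>carrier := pseudocentralizer p n h\<rparr>)
          Mod (centralizer (heisenberg (p ^ n)) h)
        \<cong> integer_mod_group p"
proof
  let ?P = "heisenberg (p ^ n)\<lparr>carrier := pseudocentralizer p n h\<rparr>"
  let ?C = "centralizer (heisenberg (p ^ n)) h"
  have p: "p \<ge> 1" using assms(1) prime_ge_1_nat by blast
  interpret G: group "heisenberg (p ^ n)"
    using p by (intro heisenberg_group) simp
  interpret P: group ?P
    using pseudocentralizer_subgroup[OF p assms(3)] G.subgroup_imp_group by blast
  interpret f: group_hom ?P "integer_mod_group p" "commutator_digit p n h"
    by (intro group_hom.intro group_hom_axioms.intro P.is_group group_integer_mod_group
        commutator_digit_hom[OF p assms(2,3)])
  show iso: "?P Mod ?C \<cong> integer_mod_group p"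
    using f.FactGroup_iso commutator_digit_surj[OF assms]
    unfolding commutator_digit_kernel[OF p assms(2,3)] by simp
  \<comment> \<open>The index is read off the isomorphism. Here \<open>p \<ge> 1\<close> matters,
    since \<open>integer_mod_group 0\<close> is the infinite group of integers.\<close>
  have "card (rcosets\<^bsub>?P\<^esub> ?C) = p"
    using iso_same_card[OF iso] p by (simp add: FactGroup_def carrier_integer_mod_group)
  moreover have "card (rcosets\<^bsub>?P\<^esub> ?C) * card ?C = order ?P"
    using P.lagrange centralizer_normal[OF p assms(3)] normal_imp_subgroup by blast
  ultimately show "card (pseudocentralizer p n h) = p * card ?C"
    by (simp add: order_def)
qed

end
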